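(* Let $X$ be a topological vector space, let $V\subset X$ be a closed convex cone, let $A,B,C\in\mathcal{C}_V^0(X)$, and suppose that $\lim(2^{-n}B)$ exists and is contained in $V$. Then the inclusion $A\dot{+}B\subset B\dot{+}C$ implies $A\subset C$.
   Context: Topological vector spaces are real. $\mathcal{C}(X)$ is the family of all nonempty closed convex subsets of $X$. The recession cone of $A\subset X$ is $\operatorname{recc}A=\{x\in X: a+tx\in A\text{ for all }a\in A,\ t\geqslant 0\}$, and $\mathcal{C}_V^0(X)=\{A\in\mathcal{C}(X): V\subset\operatorname{recc}A\}$. The addition is $A\dot{+}B=\operatorname{cl}\{a+b:a\in A,b\in B\}$, and $\lambda A=\{\lambda a:a\in A\}$ for $\lambda>0$. For a sequence $(A_n)\subset\mathcal{C}_V^0(X)$, $\lim(A_n)=A\in\mathcal{C}_V^0(X)$ means: for every neighborhood $U$ of zero in $X$ there exists $k\in\mathbb{N}$ such that $A\subset A_n+U$ and $A_n\subset A+U$ for all $n\geqslant k$. *)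

theory Defs
  imports "HOL-Analysis.Analysis"
begin

text \<open>Real topological vector spaces. No separation axiom is imposed.\<close>

class real_tvs = topological_ab_group_add + real_vector +
  assumes tendsto_scaleR_Pair:
    "LIM x (nhds r \<times>\<^sub>F nhds a). fst x *\<^sub>R snd x :> nhds (r *\<^sub>R a)"

instance real_normed_vector < real_tvs
proof
  fix r :: real and a :: 'a
  show "LIM x (nhds r \<times>\<^sub>F nhds a). fst x *\<^sub>R snd x :> nhds (r *\<^sub>R a)"
    by (intro tendsto_scaleR filterlim_fst filterlim_snd)
qed

definition recc :: "'a::real_vector set \<Rightarrow> 'a set" where
  "recc A = {x. \<forall>a\<in>A. \<forall>t\<ge>0. a + t *\<^sub>R x \<in> A}"

definition closed_convex_sets :: "'a::real_tvs set set" where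
  "closed_convex_sets = {A. A \<noteq> {} \<and> closed A \<and> convex A}"

definition closed_convex_sets_recc :: "'a::real_tvs set \<Rightarrow> 'a set set" where
  "closed_convex_sets_recc V = {A \<in> closed_convex_sets. V \<subseteq> recc A}"

definition closed_sum :: "'a::real_tvs set \<Rightarrow> 'a set \<Rightarrow> 'a set"  (infixl \<open>\<dotplus>\<close> 65) where
  "A \<dotplus> B = closure {a + b | a b. a \<in> A \<and> b \<in> B}"

text \<open>
  \<open>eventually (\<lambda>x. x \<in> U) (nhds 0)\<close> says that \<open>U\<close> is a (not necessarily open)
  neighborhood of zero. Both the terms and the limit of the sequence are required to be in
  \<open>closed_convex_sets_recc V\<close>; for the terms \<open>2\<^sup>-\<^sup>n B\<close> this is automatic
  (lemma \<open>scaled_in_closed_convex_sets_recc\<close>).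
\<close>

definition set_lim :: "'a::real_tvs set \<Rightarrow> (nat \<Rightarrow> 'a set) \<Rightarrow> 'a set \<Rightarrow> bool" where
  "set_lim V S A \<longleftrightarrow>
     (\<forall>n. S n \<in> closed_convex_sets_recc V) \<and> A \<in> closed_convex_sets_recc V \<and>
     (\<forall>U. eventually (\<lambda>x. x \<in> U) (nhds 0) \<longrightarrow>
        (\<exists>k. \<forall>n\<ge>k. A \<subseteq> {a + u | a u. a \<in> S n \<and> u \<in> U} \<and>
                   S n \<subseteq> {a + u | a u. a \<in> A \<and> u \<in> U}))"

lemma scaled_in_closed_convex_sets_recc:
  fixes V B :: "'a::real_tvs set"
  assumes B: "B \<in> closed_convex_sets_recc V" and c: "c > 0"
  shows "(\<lambda>b. c *\<^sub>R b) ` B \<in> closed_convex_sets_recc V"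
proof -
  have B': "B \<noteq> {}" "closed B" "convex B" "V \<subseteq> recc B"
    using B by (auto simp: closed_convex_sets_recc_def closed_convex_sets_def)
  have "((\<lambda>y. inverse c *\<^sub>R y) \<longlongrightarrow> inverse c *\<^sub>R x) (nhds x)" for x :: 'a
    using filterlim_compose[OF tendsto_scaleR_Pair[of "inverse c" x]
        filterlim_Pair[OF tendsto_const filterlim_ident, of "inverse c" "nhds x"]]
    by simp
  then have "((\<lambda>y. inverse c *\<^sub>R y) \<longlongrightarrow> inverse c *\<^sub>R x) (at x)" for x :: 'a
    by (rule filterlim_mono) (auto simp: at_within_def)
  then have "continuous_on UNIV (\<lambda>y::'a. inverse c *\<^sub>R y)"
    by (simp add: continuous_on_def)
  then have "closed ((\<lambda>y. inverse c *\<^sub>R y) -` B)"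
    using B'(2) by (simp add: closed_vimage)
  moreover have "(\<lambda>b. c *\<^sub>R b) ` B = (\<lambda>y. inverse c *\<^sub>R y) -` B"
    using c by (force simp: image_iff intro!: bexI[of _ "inverse c *\<^sub>R _"])
  moreover have "V \<subseteq> recc ((\<lambda>b. c *\<^sub>R b) ` B)"
  proof
    fix v assume "v \<in> V"
    then have v: "v \<in> recc B" using B' by auto
    have "c *\<^sub>R b + t *\<^sub>R v \<in> (\<lambda>b. c *\<^sub>R b) ` B" if "b \<in> B" "t \<ge> 0" for b t
    proof
      show "b + (t / c) *\<^sub>R v \<in> B" using v that c by (auto simp: recc_def)
      show "c *\<^sub>R b + t *\<^sub>R v = c *\<^sub>R (b + (t / c) *\<^sub>R v)"
        using c by (simp add: scaleR_add_right)
    qed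
    then show "v \<in> recc ((\<lambda>b. c *\<^sub>R b) ` B)" by (auto simp: recc_def)
  qed
  moreover have "convex ((\<lambda>b. c *\<^sub>R b) ` B)"
    using B'(3) by (rule convex_scaling)
  moreover have "(\<lambda>b. c *\<^sub>R b) ` B \<noteq> {}"
    using B'(1) by simp
  ultimately show ?thesis
    unfolding closed_convex_sets_recc_def closed_convex_sets_def by simp
qed

end

theory Submission
  imports Defs
begin

text \<open>
  Fix \<open>a \<in> A\<close>. The hypothesis gives \<open>a + B \<subseteq> closure (B + C)\<close>. Adding \<open>a\<close> once more and using the
  inclusion again replaces one summand \<open>a\<close> by one summand \<open>C\<close>, while the summand \<open>B\<close> is only carried
  along; after \<open>m\<close> rounds this gives \<open>m a + B \<subseteq> closure (B + m C)\<close>, where convexity collects the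
  \<open>m\<close> copies of \<open>C\<close> (\<open>absorb_multiple\<close>). Dividing by \<open>m = 2\<^sup>n\<close> yields
  \<open>a + 2\<^sup>-\<^sup>n b \<in> closure (2\<^sup>-\<^sup>n B + C)\<close> for a fixed \<open>b \<in> B\<close> (\<open>absorb_scaled\<close>).

  Now let \<open>n\<close> grow. On the left, \<open>2\<^sup>-\<^sup>n b\<close> tends to zero. On the right, \<open>2\<^sup>-\<^sup>n B\<close> lies in any prescribed
  neighborhood of its limit, hence of \<open>V\<close>, and \<open>V\<close> is swallowed by \<open>C\<close> because it consists of recession
  directions of \<open>C\<close>. So \<open>a\<close> is a limit of points of the closed set \<open>C\<close>.

  The space is not assumed locally convex, so averages of small vectors need not be small. Working
  with closures of the sets \<open>B + m C\<close>, with no error terms to average, avoids this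
  difficulty: for each \<open>n\<close> a single error term is chosen, after the division by \<open>2\<^sup>n\<close>.
\<close>

lemma tendsto_scaleR_tvs:
  fixes g :: "'b \<Rightarrow> 'a::real_tvs"
  assumes "(f \<longlongrightarrow> r) F" and "(g \<longlongrightarrow> a) F"
  shows "((\<lambda>x. f x *\<^sub>R g x) \<longlongrightarrow> r *\<^sub>R a) F"
  using filterlim_compose[OF tendsto_scaleR_Pair filterlim_Pair[OF assms]] by simp

lemma continuous_on_scaleR_tvs: "continuous_on S (\<lambda>x::'a::real_tvs. r *\<^sub>R x)"
  unfolding continuous_on_def by (intro ballI tendsto_scaleR_tvs tendsto_const tendsto_ident_at)

text \<open>
  One round of the iteration is \<open>a + closure (B + m C) \<subseteq> closure (a + B + m C) \<subseteq>
  closure (closure (B + C) + m C) \<subseteq> closure (B + (m + 1) C)\<close>. Each closure is moved outwards by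
  continuity of a translation, and the last inclusion uses \<open>C + m C \<subseteq> (m + 1) C\<close>, which is convexity.
\<close>

lemma absorb_multiple:
  fixes B C :: "'a::real_tvs set"
  assumes absorb: "\<And>b. b \<in> B \<Longrightarrow> a + b \<in> B \<dotplus> C"
    and C: "convex C" "C \<noteq> {}" and b: "b \<in> B"
  shows "real m *\<^sub>R a + b \<in> B \<dotplus> (\<lambda>c. real m *\<^sub>R c) ` C"
proof (induction m)
  case 0
  obtain c where "c \<in> C"
    using C(2) by blast
  then have "0 \<in> (\<lambda>c. real 0 *\<^sub>R c) ` C"
    by (intro image_eqI[of _ _ c]) simp_all
  moreover have "real 0 *\<^sub>R a + b = b + 0"
    by simp
  ultimately have "real 0 *\<^sub>R a + b \<in> {x + y | x y. x \<in> B \<and> y \<in> (\<lambda>c. real 0 *\<^sub>R c) ` C}"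
    using b by (intro CollectI exI[of _ b] exI[of _ 0]) simp
  then show ?case
    unfolding closed_sum_def by (rule subsetD[OF closure_subset])
next
  case (Suc m)
  let ?X = "\<lambda>m. {x + y | x y. x \<in> B \<and> y \<in> (\<lambda>c. real m *\<^sub>R c) ` C}"
  have collect: "x + c + real m *\<^sub>R d \<in> ?X (Suc m)" if "x \<in> B" "c \<in> C" "d \<in> C" for x c d
  proof -
    define e where "e = (1 / real (Suc m)) *\<^sub>R c + (real m / real (Suc m)) *\<^sub>R d"
    have "e \<in> C"
      unfolding e_def by (rule convexD[OF C(1) that(2,3)]) (simp_all add: field_simps)
    moreover have "real (Suc m) *\<^sub>R e = c + real m *\<^sub>R d"
      unfolding e_def by (simp del: of_nat_Suc add: scaleR_add_right)
    ultimately show ?thesis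
      using that(1) by (force simp: add.assoc)
  qed
  have step: "a + x \<in> closure (?X (Suc m))" if x: "x \<in> ?X m" for x
  proof -
    obtain y d where yd: "y \<in> B" "d \<in> C" "x = y + real m *\<^sub>R d"
      using x by auto
    have "(\<lambda>z. z + real m *\<^sub>R d) ` closure {x + c | x c. x \<in> B \<and> c \<in> C}
            \<subseteq> closure (?X (Suc m))"
    proof (rule image_closure_subset)
      show "(\<lambda>z. z + real m *\<^sub>R d) ` {x + c | x c. x \<in> B \<and> c \<in> C} \<subseteq> closure (?X (Suc m))"
        using collect[OF _ _ yd(2)] closure_subset[of "?X (Suc m)"] by blast
    qed (auto intro!: continuous_intros)
    then have "(a + y) + real m *\<^sub>R d \<in> closure (?X (Suc m))"
      using absorb[OF yd(1)] unfolding closed_sum_def by blast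
    then show ?thesis
      using yd(3) by (simp add: add.assoc)
  qed
  have "(\<lambda>z. a + z) ` closure (?X m) \<subseteq> closure (?X (Suc m))"
    by (rule image_closure_subset) (use step in \<open>auto intro!: continuous_intros\<close>)
  then have "a + (real m *\<^sub>R a + b) \<in> closure (?X (Suc m))"
    using Suc.IH unfolding closed_sum_def by blast
  then show ?case
    by (simp add: closed_sum_def scaleR_add_left add.assoc)
qed

text \<open>
  Dividing the iterated inclusion by \<open>m\<close> moves the factor to \<open>B\<close> alone, so that the summand to be
  cancelled is scaled down while \<open>a\<close> and \<open>C\<close> stay fixed.
\<close>

lemma absorb_scaled:
  fixes B C :: "'a::real_tvs set"
  assumes absorb: "\<And>b. b \<in> B \<Longrightarrow> a + b \<in> B \<dotplus> C"
    and C: "convex C" "C \<noteq> {}" and b: "b \<in> B" and m: "m > 0"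
  shows "a + (1 / real m) *\<^sub>R b \<in> (\<lambda>b. (1 / real m) *\<^sub>R b) ` B \<dotplus> C"
proof -
  let ?S = "{x + y | x y. x \<in> B \<and> y \<in> (\<lambda>c. real m *\<^sub>R c) ` C}"
  let ?T = "{x + y | x y. x \<in> (\<lambda>b. (1 / real m) *\<^sub>R b) ` B \<and> y \<in> C}"
  have "(\<lambda>z. (1 / real m) *\<^sub>R z) ` closure ?S \<subseteq> closure ?T"
  proof (rule image_closure_subset[OF continuous_on_scaleR_tvs])
    have "(1 / real m) *\<^sub>R (x + real m *\<^sub>R c) \<in> ?T" if "x \<in> B" "c \<in> C" for x c
      using that m by (auto simp: scaleR_add_right)
    then show "(\<lambda>z. (1 / real m) *\<^sub>R z) ` ?S \<subseteq> closure ?T"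
      using closure_subset[of ?T] by blast
  qed auto
  then have "(1 / real m) *\<^sub>R (real m *\<^sub>R a + b) \<in> closure ?T"
    using absorb_multiple[OF absorb C b, of m] unfolding closed_sum_def by blast
  then show ?thesis
    using m by (simp add: closed_sum_def scaleR_add_right)
qed

theorem theorem5p4:
  fixes V A B C :: "'a::real_tvs set"
  assumes "closed V" and "convex_cone V"
    and "A \<in> closed_convex_sets_recc V"
    and "B \<in> closed_convex_sets_recc V"
    and "C \<in> closed_convex_sets_recc V"
    and "\<exists>L. set_lim V (\<lambda>n. (\<lambda>b. (1 / 2 ^ n) *\<^sub>R b) ` B) L \<and> L \<subseteq> V"
    and "A \<dotplus> B \<subseteq> B \<dotplus> C"
  shows "A \<subseteq> C"
proof
  fix a assume a: "a \<in> A"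
  have C: "C \<noteq> {}" "closed C" "convex C" "V \<subseteq> recc C"
    using assms(5) by (auto simp: closed_convex_sets_recc_def closed_convex_sets_def)
  obtain b where b: "b \<in> B"
    using assms(4) by (auto simp: closed_convex_sets_recc_def closed_convex_sets_def)
  obtain L where L: "set_lim V (\<lambda>n. (\<lambda>b. (1 / 2 ^ n) *\<^sub>R b) ` B) L" "L \<subseteq> V"
    using assms(6) by blast
  have absorb: "a + b' \<in> B \<dotplus> C" if "b' \<in> B" for b'
  proof -
    have "a + b' \<in> A \<dotplus> B"
      unfolding closed_sum_def by (rule subsetD[OF closure_subset]) (use a that in blast)
    then show ?thesis
      using assms(7) by blast
  qed
  show "a \<in> C"
  proof (rule ccontr)
    assume "a \<notin> C"
    \<comment> \<open>The three small vectors combined in \<open>?W\<close> are, in order, \<open>2\<^sup>-\<^sup>n b\<close>, the error made in dropping the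
      closure, and the deviation of a point of \<open>2\<^sup>-\<^sup>n B\<close> from the limit \<open>L\<close>.\<close>
    let ?W = "(\<lambda>p. a + (fst p + fst (snd p) - snd (snd p))) -` (- C)"
    have "open ?W"
      by (intro open_vimage open_Compl C(2) continuous_intros)
    moreover have "(0, 0, 0) \<in> ?W"
      using \<open>a \<notin> C\<close> by simp
    ultimately have "\<exists>P W'. open P \<and> open W' \<and> (0, 0, 0) \<in> P \<times> W' \<and> P \<times> W' \<subseteq> ?W"
      by (rule open_prod_elim) blast
    then obtain P W' where P: "open P" "0 \<in> P"
      and W': "open W'" "(0, 0) \<in> W'" "P \<times> W' \<subseteq> ?W"
      by blast
    from W'(1,2) obtain Q R where Q: "open Q" "0 \<in> Q" and R: "open R" "0 \<in> R"
      and QR: "Q \<times> R \<subseteq> W'"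
      by (auto elim: open_prod_elim)
    have avoid: "a + (x + y - z) \<notin> C" if "x \<in> P" "y \<in> Q" "z \<in> R" for x y z
    proof -
      have "(y, z) \<in> W'"
        by (intro subsetD[OF QR] SigmaI that(2,3))
      then have "(x, (y, z)) \<in> ?W"
        by (intro subsetD[OF W'(3)] SigmaI that(1))
      then show ?thesis
        by simp
    qed
    have "(\<lambda>n. (1 / 2 ^ n) *\<^sub>R b) \<longlonglongrightarrow> 0 *\<^sub>R b"
      by (intro tendsto_scaleR_tvs tendsto_const LIMSEQ_divide_realpow_zero) simp
    then have "eventually (\<lambda>n. (1 / 2 ^ n) *\<^sub>R b \<in> P) sequentially"
      by (rule topological_tendstoD) (use P in auto)
    moreover have "eventually (\<lambda>x. x \<in> R) (nhds 0)"
      using R by (auto intro: eventually_nhds_in_open)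
    then have "eventually (\<lambda>n. (\<lambda>b. (1 / 2 ^ n) *\<^sub>R b) ` B \<subseteq> {l + u | l u. l \<in> L \<and> u \<in> R}) sequentially"
      using L(1) unfolding set_lim_def eventually_sequentially by meson
    ultimately have "eventually (\<lambda>n. (1 / 2 ^ n) *\<^sub>R b \<in> P \<and>
        (\<lambda>b. (1 / 2 ^ n) *\<^sub>R b) ` B \<subseteq> {l + u | l u. l \<in> L \<and> u \<in> R}) sequentially"
      by (rule eventually_conj)
    then obtain n where nP: "(1 / 2 ^ n) *\<^sub>R b \<in> P"
      and nR: "(\<lambda>b. (1 / 2 ^ n) *\<^sub>R b) ` B \<subseteq> {l + u | l u. l \<in> L \<and> u \<in> R}"
      using eventually_happens'[OF sequentially_bot] by blast
    let ?p = "a + (1 / 2 ^ n) *\<^sub>R b"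
    define T where "T = {x + y | x y. x \<in> (\<lambda>b. (1 / 2 ^ n) *\<^sub>R b) ` B \<and> y \<in> C}"
    define N where "N = (\<lambda>t. t - ?p) -` Q"
    have "?p \<in> closure T"
      using absorb_scaled[OF absorb C(3,1) b, of "2 ^ n"] by (simp add: closed_sum_def T_def)
    moreover have "?p \<in> N"
      using Q by (simp add: N_def)
    moreover have "open N"
      unfolding N_def by (intro open_vimage Q continuous_intros)
    ultimately have "N \<inter> T \<noteq> {}"
      using open_Int_closure_eq_empty[of N T] by blast
    then obtain t where t: "t \<in> T" "t - ?p \<in> Q"
      by (auto simp: N_def)
    from t(1) obtain s c where s: "s \<in> (\<lambda>b. (1 / 2 ^ n) *\<^sub>R b) ` B" and c: "c \<in> C" "t = s + c"
      unfolding T_def by (elim CollectE exE conjE)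
    from subsetD[OF nR s] obtain l u where lu: "l \<in> L" "u \<in> R" "s = l + u"
      by (elim CollectE exE conjE)
    have "l \<in> recc C"
      using lu(1) L(2) C(4) by blast
    then have "c + 1 *\<^sub>R l \<in> C"
      using c(1) zero_le_one unfolding recc_def by blast
    moreover have "a + ((1 / 2 ^ n) *\<^sub>R b + (t - ?p) - u) = c + 1 *\<^sub>R l"
      using lu(3) c(2) by (simp add: algebra_simps)
    ultimately show False
      using avoid[OF nP t(2) lu(2)] by argo
  qed
qed

end
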